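(* Let $G$ be a finite-by-abelian group. Then the following are equivalent: (i) $|G/Z(G)|<\omega_1$ (i.e. $G/Z(G)$ is countable); (ii) $[G:N_G(U)]<\omega_1$ for every subgroup $U\le G$; (iii) $[G:N_G(A)]<\omega_1$ for every abelian subgroup $A\le G$.
   Context: A group $G$ is finite-by-abelian if its derived subgroup $G'$ is finite. $Z(G)$ is the centre of $G$ and $N_G(U)$ the normalizer of $U$ in $G$. *)

theory Defs
  imports "HOL-Algebra.Algebra" "HOL-Library.Countable_Set"
begin

definition group_center :: "('a, 'b) monoid_scheme \<Rightarrow> 'a set" where
  "group_center G = {z \<in> carrier G. \<forall>g \<in> carrier G. z \<otimes>\<^bsub>G\<^esub> g = g \<otimes>\<^bsub>G\<^esub> z}"

definition finite_by_abelian :: "('a, 'b) monoid_scheme \<Rightarrow> bool" where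
  "finite_by_abelian G \<longleftrightarrow> group G \<and> finite (derived G (carrier G))"

text \<open>The library's normalizer is the stabilizer of a subset under conjugation. The next two lemmas
  confirm that on a subgroup \<open>U\<close> this is the usual normalizer, and that the quotient by the
  centre is a quotient by a normal subgroup.\<close>

lemma (in group) mem_normalizer_iff:
  assumes "subgroup U G"
  shows "g \<in> normalizer G U \<longleftrightarrow>
    g \<in> carrier G \<and> (\<lambda>u. g \<otimes> u \<otimes> inv g) ` U = U"
proof -
  have "g <# U #> inv g = (\<lambda>u. g \<otimes> u \<otimes> inv g) ` U"
    by (auto simp: l_coset_def r_coset_def)
  then show ?thesis
    using subgroup.subset[OF assms] by (auto simp: normalizer_def stabilizer_def)
qed

lemma (in group) group_center_normal: "group_center G \<lhd> G"
proof -
  have sub: "subgroup (group_center G) G"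
  proof (rule subgroupI)
    show "group_center G \<subseteq> carrier G" "group_center G \<noteq> {}"
      by (auto simp: group_center_def)
  next
    fix a assume a: "a \<in> group_center G"
    then have c: "a \<in> carrier G" "\<And>g. g \<in> carrier G \<Longrightarrow> a \<otimes> g = g \<otimes> a"
      by (auto simp: group_center_def)
    have "inv a \<otimes> g = g \<otimes> inv a" if g: "g \<in> carrier G" for g
    proof -
      have "inv (a \<otimes> inv g) = inv (inv g \<otimes> a)" using c g by simp
      then show ?thesis using c(1) g by (simp add: inv_mult_group)
    qed
    then show "inv a \<in> group_center G" using c(1) by (simp add: group_center_def)
  next
    fix a b assume "a \<in> group_center G" "b \<in> group_center G"
    then have ab: "a \<in> carrier G" "b \<in> carrier G"
      "\<And>g. g \<in> carrier G \<Longrightarrow> a \<otimes> g = g \<otimes> a" "\<And>g. g \<in> carrier G \<Longrightarrow> b \<otimes> g = g \<otimes> b"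
      by (auto simp: group_center_def)
    have "a \<otimes> b \<otimes> g = g \<otimes> (a \<otimes> b)" if g: "g \<in> carrier G" for g
      using ab(1,2) ab(3)[OF g] ab(4)[OF g] g by (metis m_assoc)
    then show "a \<otimes> b \<in> group_center G" using ab(1,2) by (simp add: group_center_def)
  qed
  have "x \<otimes> h \<otimes> inv x \<in> group_center G" if x: "x \<in> carrier G" and h: "h \<in> group_center G" for x h
  proof -
    have "h \<in> carrier G" "x \<otimes> h = h \<otimes> x" using x h by (auto simp: group_center_def)
    then have "x \<otimes> h \<otimes> inv x = h" using x by (simp add: m_assoc)
    then show ?thesis using h by simp
  qed
  with sub show ?thesis by (auto simp: normal_inv_iff)
qed

end

theory Submission
  imports Defs
begin

text \<open>Only the implication from countable normalizer indices of abelian subgroups to countable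
  \<open>G / Z(G)\<close> has content. Put \<open>D = G'\<close> and \<open>C = C\<^sub>G(D)\<close>. As \<open>D\<close> is finite, \<open>C\<close> has finite index and
  commutators are bilinear on \<open>C\<close>. If \<open>Z(G)\<close> has uncountable index, then some abelian \<open>B \<le> C\<close> has a
  centralizer of uncountable index: either a maximal abelian subgroup of \<open>C\<close> does, or else a countable
  subgroup \<open>H\<close> of \<open>C\<close> does. In the latter case, let \<open>E\<close> be a finite group containing the commutators of
  \<open>H\<close> and \<open>E\<^sub>0\<close> a maximal proper subgroup of \<open>E\<close>. Modulo \<open>E\<^sub>0\<close> the commutator is an alternating form
  with values in a group of prime order, and a Gram-Schmidt procedure generates \<open>H\<close> by two isotropic
  subgroups. One of them still has a centralizer of uncountable index, and its commutators lie in
  \<open>E\<^sub>0\<close>, so one descends to \<open>E = 1\<close>.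

  Next \<open>B\<close> is shrunk until \<open>B \<inter> D = 1\<close>. Take \<open>d \<in> B \<inter> D\<close> of prime order and \<open>A \<le> B\<close> maximal
  with \<open>d \<notin> A\<close>. Every nontrivial subgroup of \<open>B / A\<close> contains \<open>d\<close>, so \<open>B / A\<close> embeds into a
  Pruefer group and its cyclic subgroups form a chain. Homomorphisms from \<open>B / A\<close> into a finite
  group are therefore controlled by a single element of \<open>B\<close>, and passing to \<open>A\<close> keeps the centralizer
  index uncountable. Finally \<open>B \<inter> D = 1\<close> forces the normalizer of \<open>B\<close> to centralize \<open>B\<close>.\<close>

subsection \<open>Centralizers and subgroups of countable index\<close>

abbreviation countable_index :: "('a, 'b) monoid_scheme \<Rightarrow> 'a set \<Rightarrow> bool"
  where "countable_index G K \<equiv> countable (rcosets\<^bsub>G\<^esub> K)"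

definition centralizer :: "('a, 'b) monoid_scheme \<Rightarrow> 'a set \<Rightarrow> 'a set"
  where "centralizer G S = {g \<in> carrier G. \<forall>s\<in>S. g \<otimes>\<^bsub>G\<^esub> s = s \<otimes>\<^bsub>G\<^esub> g}"

text \<open>The factors are ordered as in the generators of \<open>derived\<close>, so commutators
  lie in the derived subgroup by definition.\<close>

definition commutator :: "('a, 'b) monoid_scheme \<Rightarrow> 'a \<Rightarrow> 'a \<Rightarrow> 'a"
  where "commutator G x y = x \<otimes>\<^bsub>G\<^esub> y \<otimes>\<^bsub>G\<^esub> inv\<^bsub>G\<^esub> x \<otimes>\<^bsub>G\<^esub> inv\<^bsub>G\<^esub> y"

context group
begin

lemma subgroup_centralizer:
  assumes "S \<subseteq> carrier G"
  shows "subgroup (centralizer G S) G"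
proof (rule subgroupI)
  fix a assume a: "a \<in> centralizer G S"
  then have a': "a \<in> carrier G" by (simp add: centralizer_def)
  have "inv a \<otimes> s = s \<otimes> inv a" if s: "s \<in> S" for s
  proof -
    have s': "s \<in> carrier G" and "a \<otimes> s = s \<otimes> a"
      using a s assms by (auto simp: centralizer_def)
    then have "a \<otimes> (s \<otimes> inv a) = a \<otimes> (inv a \<otimes> s)"
      using a' by (simp add: m_assoc[symmetric]) (simp add: m_assoc)
    then show ?thesis using a' s' by simp
  qed
  then show "inv a \<in> centralizer G S" using a' by (simp add: centralizer_def)
next
  fix a b assume a: "a \<in> centralizer G S" and b: "b \<in> centralizer G S"
  have "a \<otimes> b \<otimes> s = s \<otimes> (a \<otimes> b)" if s: "s \<in> S" for s
    using a b s assms unfolding centralizer_def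
    by (smt (verit) m_assoc mem_Collect_eq subset_iff)
  then show "a \<otimes> b \<in> centralizer G S" using a b by (simp add: centralizer_def)
next
  have "\<one> \<in> centralizer G S" using assms by (auto simp: centralizer_def)
  then show "centralizer G S \<noteq> {}" by blast
qed (simp add: centralizer_def subset_iff)

text \<open>\<open>S\<close> lies in its double centralizer, which is a subgroup and therefore
  contains all of \<open>generate G S\<close>.\<close>

lemma centralizer_generate:
  assumes "S \<subseteq> carrier G"
  shows "centralizer G (generate G S) = centralizer G S"
proof
  show "centralizer G (generate G S) \<subseteq> centralizer G S"
    by (auto simp: centralizer_def generate.incl)
  have "generate G S \<subseteq> centralizer G (centralizer G S)"
    using assms by (intro generate_subgroup_incl subgroup_centralizer) (auto simp: centralizer_def)
  then show "centralizer G S \<subseteq> centralizer G (generate G S)"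
    by (auto simp: centralizer_def subset_iff)
qed

lemma centralizer_carrier: "centralizer G (carrier G) = group_center G"
  by (simp add: centralizer_def group_center_def)

lemma rcos_eq_iff:
  assumes "subgroup K G" "x \<in> carrier G" "y \<in> carrier G"
  shows "K #> x = K #> y \<longleftrightarrow> x \<otimes> inv y \<in> K"
  by (metis assms is_group rcos_self repr_independence subgroup.rcos_module)

text \<open>The basic criterion for countable index: each fibre of \<open>f\<close> lies in a single
  right coset of \<open>K\<close>, so one chosen point per value of \<open>f\<close> meets every
  coset.\<close>

lemma countable_index_if_separating:
  assumes K: "subgroup K G" and cnt: "countable (f ` carrier G)"
    and sep: "\<And>x y. x \<in> carrier G \<Longrightarrow> y \<in> carrier G \<Longrightarrow> f x = f y \<Longrightarrow> x \<otimes> inv y \<in> K"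
  shows "countable_index G K"
proof -
  have "rcosets K \<subseteq> (\<lambda>v. K #> inv_into (carrier G) f v) ` (f ` carrier G)"
  proof
    fix C assume "C \<in> rcosets K"
    then obtain x where x: "x \<in> carrier G" "C = K #> x" by (auto simp: RCOSETS_def)
    let ?y = "inv_into (carrier G) f (f x)"
    have y: "?y \<in> carrier G" "f ?y = f x"
      using x by (auto intro: inv_into_into f_inv_into_f)
    then have "x \<otimes> inv ?y \<in> K" using sep x by metis
    then have "K #> x = K #> ?y"
      using K x y by (metis coset_join2 coset_mult_inv1 inv_closed m_closed subgroup.subset)
    then show "C \<in> (\<lambda>v. K #> inv_into (carrier G) f v) ` (f ` carrier G)" using x by auto
  qed
  then show ?thesis using cnt by (meson countable_image countable_subset)
qed

lemma countable_index_mono: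
  assumes "countable_index G K" "subgroup K G" "subgroup L G" "K \<subseteq> L"
  shows "countable_index G L"
proof (rule countable_index_if_separating[where f = "(#>) K"])
  show "countable ((#>) K ` carrier G)"
    using assms(1) by (rule countable_subset[rotated]) (auto simp: RCOSETS_def)
qed (use assms rcos_eq_iff in auto)

lemma countable_index_Int:
  assumes "countable_index G K" "countable_index G L" "subgroup K G" "subgroup L G"
  shows "countable_index G (K \<inter> L)"
proof (rule countable_index_if_separating[where f = "\<lambda>x. (K #> x, L #> x)"])
  show "countable ((\<lambda>x. (K #> x, L #> x)) ` carrier G)"
    using countable_SIGMA[OF assms(1,2)] by (rule countable_subset[rotated]) (auto simp: RCOSETS_def)
qed (use assms rcos_eq_iff subgroups_Inter_pair in auto)

section \<open>Commutator identities\<close>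

lemma commutator_closed [simp, intro]:
  "x \<in> carrier G \<Longrightarrow> y \<in> carrier G \<Longrightarrow> commutator G x y \<in> carrier G"
  by (simp add: commutator_def)

lemma commutator_eq_one_iff:
  assumes "x \<in> carrier G" "y \<in> carrier G"
  shows "commutator G x y = \<one> \<longleftrightarrow> x \<otimes> y = y \<otimes> x"
proof -
  have "commutator G x y = x \<otimes> y \<otimes> inv (y \<otimes> x)"
    using assms by (simp add: commutator_def inv_mult_group m_assoc)
  then show ?thesis
    using assms by (metis inv_equality inv_inv m_closed inv_closed r_inv)
qed

lemma commutator_mult_commute:
  assumes "x \<in> carrier G" "y \<in> carrier G"
  shows "commutator G x y \<otimes> y = x \<otimes> y \<otimes> inv x"
  using assms by (simp add: commutator_def m_assoc)

lemma inv_commutator: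
  assumes "x \<in> carrier G" "y \<in> carrier G"
  shows "inv (commutator G x y) = commutator G y x"
  using assms by (simp add: commutator_def inv_mult_group m_assoc)

text \<open>In general \<open>[xy, z]\<close> is the conjugate of \<open>[y, z]\<close> by
  \<open>x\<close>, times \<open>[x, z]\<close>. The last hypothesis removes the conjugation, and
  the factors keep this order.\<close>

lemma commutator_mult_left:
  assumes "x \<in> carrier G" "y \<in> carrier G" "z \<in> carrier G"
    and "commutator G y z \<otimes> x = x \<otimes> commutator G y z"
  shows "commutator G (x \<otimes> y) z = commutator G y z \<otimes> commutator G x z"
proof -
  have "commutator G (x \<otimes> y) z = x \<otimes> (commutator G y z \<otimes> z) \<otimes> inv x \<otimes> inv z"
    using assms(1-3) by (simp add: commutator_mult_commute) (simp add: commutator_def inv_mult_group m_assoc)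
  also have "\<dots> = (x \<otimes> commutator G y z) \<otimes> (z \<otimes> inv x \<otimes> inv z)"
    using assms(1-3) by (simp add: m_assoc)
  also have "\<dots> = commutator G y z \<otimes> (x \<otimes> (z \<otimes> inv x \<otimes> inv z))"
    using assms(1-3) unfolding assms(4)[symmetric] by (simp add: m_assoc)
  also have "\<dots> = commutator G y z \<otimes> commutator G x z"
    using assms(1-3) by (simp add: commutator_def m_assoc)
  finally show ?thesis .
qed

text \<open>Conjugation by \<open>w\<close> is an endomorphism sending \<open>y\<close> to
  \<open>[w, y] y\<close>. As these two factors commute, integer powers split over the
  product.\<close>

lemma commutator_int_pow_right:
  assumes "w \<in> carrier G" "y \<in> carrier G"
    and c: "commutator G w y \<otimes> y = y \<otimes> commutator G w y"
  shows "commutator G w (y [^] (k::int)) = commutator G w y [^] k"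
proof -
  have "(\<lambda>x. w \<otimes> x \<otimes> inv w) \<in> hom G G"
    using assms(1) by (auto simp: hom_def m_assoc) (simp flip: m_assoc)
  then have "w \<otimes> y [^] k \<otimes> inv w = (w \<otimes> y \<otimes> inv w) [^] k"
    using hom_int_pow[OF _ assms(2) is_group is_group] by blast
  also have "\<dots> = commutator G w y [^] k \<otimes> y [^] k"
    using assms int_pow_mult_distrib[OF c] by (simp flip: commutator_mult_commute)
  finally show ?thesis
    using assms by (simp add: commutator_def[of G w "y [^] k"] m_assoc)
qed

lemma commutator_in_derived:
  "x \<in> carrier G \<Longrightarrow> y \<in> carrier G \<Longrightarrow> commutator G x y \<in> derived G (carrier G)"
  unfolding derived_def commutator_def by (intro generate.incl) auto

section \<open>Conjugacy classes and centralizers of finite sets\<close>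

lemma conj_eq_imp_centralizes:
  assumes "x \<in> carrier G" "g \<in> carrier G" "h \<in> carrier G"
    and eq: "inv g \<otimes> x \<otimes> g = inv h \<otimes> x \<otimes> h"
  shows "(g \<otimes> inv h) \<otimes> x = x \<otimes> (g \<otimes> inv h)"
proof -
  have "x \<otimes> g = g \<otimes> (inv g \<otimes> x \<otimes> g)" using assms(1-3) by (simp add: m_assoc[symmetric])
  also have "\<dots> = g \<otimes> (inv h \<otimes> x \<otimes> h)" using eq by simp
  finally have "x \<otimes> g \<otimes> inv h = g \<otimes> (inv h \<otimes> x \<otimes> h) \<otimes> inv h" by simp
  then show ?thesis using assms by (simp add: m_assoc)
qed

text \<open>The conjugate is \<open>[inv g, x] x\<close>. Hence the conjugacy class of
  \<open>x\<close> lies in one coset of the derived subgroup and is finite when that subgroup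
  is.\<close>

lemma conj_in_derived_coset:
  assumes "x \<in> carrier G" "g \<in> carrier G"
  shows "inv g \<otimes> x \<otimes> g \<in> (\<lambda>c. c \<otimes> x) ` derived G (carrier G)"
proof
  show "inv g \<otimes> x \<otimes> g = commutator G (inv g) x \<otimes> x"
    using assms by (simp add: commutator_mult_commute)
qed (use assms in \<open>simp add: commutator_in_derived\<close>)

lemma countable_index_centralizer_singleton:
  assumes "finite (derived G (carrier G))" "x \<in> carrier G"
  shows "countable_index G (centralizer G {x})"
proof (rule countable_index_if_separating[where f = "\<lambda>g. inv g \<otimes> x \<otimes> g"])
  have "(\<lambda>g. inv g \<otimes> x \<otimes> g) ` carrier G \<subseteq> (\<lambda>c. c \<otimes> x) ` derived G (carrier G)"
    using conj_in_derived_coset[OF assms(2)] by blast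
  then show "countable ((\<lambda>g. inv g \<otimes> x \<otimes> g) ` carrier G)"
    using assms(1) by (meson countable_finite finite_imageI finite_subset)
next
  show "subgroup (centralizer G {x}) G" using assms by (simp add: subgroup_centralizer)
qed (use assms(2) conj_eq_imp_centralizes in \<open>auto simp: centralizer_def\<close>)

lemma countable_index_centralizer_finite:
  assumes fin: "finite (derived G (carrier G))" and "finite S" "S \<subseteq> carrier G"
  shows "countable_index G (centralizer G S)"
  using assms(2,3)
proof (induction S)
  case empty
  show ?case
    by (rule countable_index_if_separating[where f = "\<lambda>_. ()"])
      (simp_all add: subgroup_centralizer, simp add: centralizer_def)
next
  case (insert x S)
  have "centralizer G (insert x S) = centralizer G {x} \<inter> centralizer G S"
    by (auto simp: centralizer_def)
  then show ?case
    using insert countable_index_centralizer_singleton[OF fin] by (simp add: countable_index_Int subgroup_centralizer)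
qed

text \<open>Elements are sorted by their conjugation action on the finite derived subgroup, and one
  is chosen for each action. Finiteness of \<open>R\<close> matters later, because it makes the
  centralizer of \<open>R\<close> of countable index.\<close>

lemma finite_transversal_centralizer_derived:
  assumes fin: "finite (derived G (carrier G))"
  obtains R where "finite R" "R \<subseteq> carrier G"
    "\<And>g. g \<in> carrier G \<Longrightarrow> \<exists>r\<in>R. g \<otimes> inv r \<in> centralizer G (derived G (carrier G))"
proof -
  let ?D = "derived G (carrier G)"
  have D: "?D \<subseteq> carrier G" by (simp add: derived_in_carrier)
  \<comment> \<open>Restricting to \<open>?D\<close> places \<open>f g\<close> in a product of
    finitely many finite sets.\<close>
  define f where "f g = (\<lambda>d\<in>?D. inv g \<otimes> d \<otimes> g)" for g
  have "f ` carrier G \<subseteq> (\<Pi>\<^sub>E d\<in>?D. (\<lambda>c. c \<otimes> d) ` ?D)"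
    using D conj_in_derived_coset unfolding f_def by (auto simp: PiE_def Pi_def)
  then have finf: "finite (f ` carrier G)"
    using fin by (meson finite_PiE finite_imageI finite_subset)
  show ?thesis
  proof (rule that[of "inv_into (carrier G) f ` (f ` carrier G)"])
    show "inv_into (carrier G) f ` (f ` carrier G) \<subseteq> carrier G"
      by (auto intro: inv_into_into)
    fix g assume g: "g \<in> carrier G"
    let ?r = "inv_into (carrier G) f (f g)"
    have r: "?r \<in> carrier G" "f ?r = f g" using g by (auto intro: inv_into_into f_inv_into_f)
    have "(g \<otimes> inv ?r) \<otimes> d = d \<otimes> (g \<otimes> inv ?r)" if d: "d \<in> ?D" for d
    proof (rule conj_eq_imp_centralizes)
      show "inv g \<otimes> d \<otimes> g = inv ?r \<otimes> d \<otimes> ?r"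
        using fun_cong[OF r(2), of d] d by (simp add: f_def)
    qed (use d D g r in auto)
    then have "g \<otimes> inv ?r \<in> centralizer G ?D" using g r by (simp add: centralizer_def)
    then show "\<exists>r\<in>inv_into (carrier G) f ` (f ` carrier G). g \<otimes> inv r \<in> centralizer G ?D"
      using g by blast
  qed (use finf in simp)
qed

end

subsection \<open>Maximal subgroups avoiding an element of prime order\<close>

text \<open>Since \<open>d\<close> lies in every nontrivial cyclic subgroup, all orders are powers
  of \<open>p\<close> and there is only one subgroup of order \<open>p\<close>. This makes the
  cyclic subgroups a chain, ordered by the orders of their generators.\<close>

lemma (in comm_group) powers_comparable_if_essential:
  fixes p :: nat
  assumes p: "Factorial_Ring.prime p" and d: "d \<in> carrier G" "d \<noteq> \<one>" "d [^] p = \<one>"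
    and ess: "\<And>x. x \<in> carrier G \<Longrightarrow> x \<noteq> \<one> \<Longrightarrow> \<exists>k::int. d = x [^] k"
    and x: "x \<in> carrier G" and y: "y \<in> carrier G"
  shows "(\<exists>k::int. x = y [^] k) \<or> (\<exists>k::int. y = x [^] k)"
proof -
  have ord_d: "ord d = p"
    using p d by (metis ord_eq_1 pow_eq_id prime_nat_iff)
  have ord_power: "\<exists>a. ord z = p ^ a" if z: "z \<in> carrier G" for z
  proof (cases "z = \<one>")
    case True
    then show ?thesis by (metis ord_id power_0)
  next
    case False
    then obtain k :: int where k: "d = z [^] k" using ess z by blast
    have "z [^] (k * int p) = \<one>"
      using d k z by (simp add: int_pow_pow[symmetric] int_pow_int)
    then have "int (ord z) dvd k * int p" using z by (simp add: int_pow_eq_id)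
    \<comment> \<open>This excludes infinite order, which is encoded as \<open>ord z = 0\<close>;
      \<open>k\<close> is nonzero because \<open>d\<close> is nontrivial.\<close>
    moreover have "k * int p \<noteq> 0" using k d p by (auto simp: prime_gt_0_nat)
    ultimately have "ord z \<noteq> 0" by (metis dvd_0_left_iff of_nat_0)
    then obtain r where r: "ord z = p ^ multiplicity p (ord z) * r" "\<not> p dvd r"
      using p by (metis multiplicity_decompose' not_prime_unit)
    \<comment> \<open>A prime \<open>q\<close> dividing \<open>r\<close> would give the element
      \<open>z [^] m\<close> of order \<open>q\<close>. As \<open>d\<close> is one of its powers,
      \<open>d [^] q\<close> is trivial, which forces \<open>q = p\<close>.\<close>
    have "r = 1"
    proof (rule ccontr)
      assume "r \<noteq> 1"
      then obtain q where q: "Factorial_Ring.prime q" "q dvd r" using prime_factor_nat by blast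
      then have "q dvd ord z" using r(1) by (metis dvd_mult)
      then obtain m where m: "ord z = q * m" by blast
      have "m \<noteq> 0" "q > 1" using \<open>ord z \<noteq> 0\<close> m q prime_gt_1_nat by auto
      then have "\<not> ord z dvd m" using m by (simp add: nat_dvd_not_less)
      then have "z [^] m \<noteq> \<one>" using z by (simp add: pow_eq_id)
      then obtain j :: int where j: "d = (z [^] m) [^] j" using ess z by (meson nat_pow_closed)
      have "d [^] (int q) = ((z [^] m) [^] (int q)) [^] j"
        using z unfolding j by (simp add: int_pow_pow mult.commute)
      also have "(z [^] m) [^] (int q) = \<one>"
        using z m pow_ord_eq_1[OF z] by (simp add: int_pow_int nat_pow_pow mult.commute)
      finally have "d [^] q = \<one>" by (simp add: int_pow_int)
      then have "p dvd q" using d ord_d by (simp add: pow_eq_id)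
      then show False using p q r(2) primes_dvd_imp_eq by blast
    qed
    then show ?thesis using r(1) by auto
  qed
  \<comment> \<open>Induction on \<open>a\<close>: dividing \<open>x\<close> by a suitable power of
    \<open>y\<close> lowers the exponent that kills it.\<close>
  have main: "\<exists>k::int. x = y [^] k"
    if "x \<in> carrier G" "y \<in> carrier G" "x [^] int (p ^ a) = \<one>" "p ^ a dvd ord y" for x y a
    using that
  proof (induction a arbitrary: x)
    case 0
    then have "x = y [^] (0::int)" by simp
    then show ?case by blast
  next
    case (Suc a)
    note x = Suc.prems(1) and y = Suc.prems(2)
    define u where "u = x [^] int (p ^ a)"
    have u: "u \<in> carrier G" using x by (simp add: u_def)
    have pa: "p ^ a dvd ord y" using Suc.prems(4) by (auto simp: dvd_def)
    show ?case
    proof (cases "u = \<one>")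
      case True
      then show ?thesis using Suc.IH x y pa by (simp add: u_def)
    next
      case False
      have up: "u [^] int p = \<one>"
        using Suc.prems(3) x by (simp add: u_def int_pow_pow mult.commute)
      obtain m where m: "ord y = p ^ Suc a * m" using Suc.prems(4) by blast
      have "ord y \<noteq> 0" using ord_power[OF y] prime_gt_0_nat[OF p] by auto
      then have "m \<noteq> 0" "p ^ a * m < ord y" using m prime_gt_1_nat[OF p] by auto
      then have "\<not> ord y dvd p ^ a * m" using p by (simp add: nat_dvd_not_less prime_gt_0_nat)
      then have "y [^] (p ^ a * m) \<noteq> \<one>" using y by (simp add: pow_eq_id)
      then have "y [^] int (p ^ a * m) \<noteq> \<one>" unfolding int_pow_int .
      then obtain k :: int where k: "d = (y [^] int (p ^ a * m)) [^] k"
        using ess y by (meson int_pow_closed)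
      obtain j :: int where j: "d = u [^] j" using ess u False by blast
      have "\<not> int p dvd j"
      proof
        assume "int p dvd j"
        then obtain l where "j = int p * l" by blast
        then have "d = (u [^] int p) [^] l" using j u by (simp add: int_pow_pow)
        then show False using up d by simp
      qed
      then have "coprime j (int p)"
        using p by (metis coprime_commute prime_imp_coprime prime_nat_int_transfer)
      \<comment> \<open>Inverting \<open>j\<close> modulo \<open>p\<close> turns \<open>u\<close>
        into a power of \<open>d\<close>, hence into the \<open>p ^ a\<close>-th power of some power
        \<open>w\<close> of \<open>y\<close>. Then \<open>x \<otimes> inv w\<close> is killed by
        \<open>p ^ a\<close>, and the induction hypothesis applies to it.\<close>
      then obtain i l :: int where il: "i * j + l * int p = 1"
        by (metis bezout_int coprime_imp_gcd_eq_1)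
      have "u = u [^] (j * i + int p * l)" using il u by (simp add: mult.commute)
      also have "\<dots> = (u [^] j) [^] i \<otimes> (u [^] int p) [^] l"
        using u by (simp only: int_pow_mult int_pow_pow)
      also have "\<dots> = d [^] i" using up u j by simp
      also have "\<dots> = (y [^] (int m * k * i)) [^] int (p ^ a)"
        using y by (simp add: k int_pow_pow algebra_simps)
      finally have u': "u = (y [^] (int m * k * i)) [^] int (p ^ a)" .
      define w where "w = y [^] (int m * k * i)"
      have w: "w \<in> carrier G" using y by (simp add: w_def)
      have "(x \<otimes> inv w) [^] int (p ^ a) = u \<otimes> inv (w [^] int (p ^ a))"
        using x w unfolding u_def by (metis int_pow_inv int_pow_distrib inv_closed)
      also have "\<dots> = \<one>" using u' u by (simp add: w_def)
      finally obtain l :: int where "x \<otimes> inv w = y [^] l"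
        using Suc.IH[of "x \<otimes> inv w"] x w y pa by auto
      then have "x = y [^] l \<otimes> w" using x w by (metis inv_solve_right' m_closed int_pow_closed y)
      also have "\<dots> = y [^] (l + int m * k * i)" using y by (simp add: w_def int_pow_mult)
      finally show ?thesis by blast
    qed
  qed
  obtain a b where ab: "ord x = p ^ a" "ord y = p ^ b" using ord_power x y by blast
  then have "x [^] int (p ^ a) = \<one>" "y [^] int (p ^ b) = \<one>"
    using x y by (metis int_pow_int pow_ord_eq_1)+
  moreover have "p ^ a dvd p ^ b \<or> p ^ b dvd p ^ a" by (meson le_imp_power_dvd nat_le_linear)
  ultimately show ?thesis using main x y ab by metis
qed

text \<open>By maximality of \<open>A\<close>, every subgroup properly containing \<open>A\<close>
  contains \<open>d\<close>. In the quotient by \<open>A\<close>, the image of \<open>d\<close> is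
  therefore a power of every nontrivial element, and the preceding lemma applies there.\<close>

lemma (in comm_group) comparable_mod_maximal_avoiding:
  fixes p :: nat
  assumes p: "Factorial_Ring.prime p" and A: "subgroup A G"
    and d: "d \<in> carrier G" "d \<notin> A" "d [^] p = \<one>"
    and max: "\<And>H. subgroup H G \<Longrightarrow> A \<subseteq> H \<Longrightarrow> d \<notin> H \<Longrightarrow> H = A"
    and x: "x \<in> carrier G" and y: "y \<in> carrier G"
  shows "(\<exists>k::int. x \<otimes> inv (y [^] k) \<in> A) \<or> (\<exists>k::int. y \<otimes> inv (x [^] k) \<in> A)"
proof -
  interpret A: normal A G using A by (rule subgroup_imp_normal)
  interpret Q: comm_group "G Mod A" using A by (rule abelian_FactGroup)
  have eq: "A #> g = A #> h \<longleftrightarrow> g \<otimes> inv h \<in> A" if "g \<in> carrier G" "h \<in> carrier G" for g h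
    using rcos_eq_iff[OF A that] .
  have one: "\<one>\<^bsub>G Mod A\<^esub> = A #> \<one>" using A.subset by (simp add: FactGroup_def)
  have pow: "(A #> g) [^]\<^bsub>G Mod A\<^esub> (k::int) = A #> (g [^] k)" if "g \<in> carrier G" for g k
    using that by (rule A.FactGroup_int_pow)
  have car: "g \<in> carrier G \<Longrightarrow> A #> g \<in> carrier (G Mod A)" for g
    by (auto simp: FactGroup_def RCOSETS_def)
  have ess: "\<exists>k::int. A #> d = C [^]\<^bsub>G Mod A\<^esub> k"
    if C: "C \<in> carrier (G Mod A)" "C \<noteq> \<one>\<^bsub>G Mod A\<^esub>" for C
  proof -
    obtain z where z: "z \<in> carrier G" "C = A #> z" using C by (auto simp: FactGroup_def RCOSETS_def)
    then have "z \<notin> A" using C(2) one eq[of z \<one>] by auto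
    \<comment> \<open>This is the subgroup generated by \<open>A\<close> and \<open>z\<close>, the
      preimage of the cyclic group generated by the coset of \<open>z\<close>.\<close>
    let ?H = "{g \<in> carrier G. \<exists>k::int. g \<otimes> inv (z [^] k) \<in> A}"
    have "subgroup ?H G"
    proof (rule subgroupI)
      have "\<one> \<otimes> inv (z [^] (0::int)) \<in> A" by simp
      then show "?H \<noteq> {}" by blast
    next
      fix a assume "a \<in> ?H"
      then obtain k :: int where k: "a \<in> carrier G" "a \<otimes> inv (z [^] k) \<in> A" by blast
      have "inv a \<otimes> inv (z [^] (- k)) = inv (a \<otimes> inv (z [^] k))"
        using k z by (simp add: int_pow_neg inv_mult m_comm)
      then have "inv a \<otimes> inv (z [^] (- k)) \<in> A" using k(2) by simp
      then show "inv a \<in> ?H" using k by blast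
    next
      fix a b assume "a \<in> ?H" "b \<in> ?H"
      then obtain k l :: int where k: "a \<in> carrier G" "a \<otimes> inv (z [^] k) \<in> A"
        and l: "b \<in> carrier G" "b \<otimes> inv (z [^] l) \<in> A" by blast
      have "a \<otimes> b \<otimes> inv (z [^] (k + l)) = (a \<otimes> inv (z [^] k)) \<otimes> (b \<otimes> inv (z [^] l))"
        using k(1) l(1) z by (simp add: int_pow_mult inv_mult m_ac)
      then have "a \<otimes> b \<otimes> inv (z [^] (k + l)) \<in> A" using k(2) l(2) by simp
      then show "a \<otimes> b \<in> ?H" using k l by blast
    qed auto
    moreover have "A \<subseteq> ?H"
    proof
      fix a assume "a \<in> A"
      then have "a \<in> carrier G" "a \<otimes> inv (z [^] (0::int)) \<in> A" using A.subset by auto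
      then show "a \<in> ?H" by blast
    qed
    moreover have "z \<in> ?H"
    proof -
      have "z \<otimes> inv (z [^] (1::int)) \<in> A" using z by simp
      then show ?thesis using z by blast
    qed
    ultimately have "d \<in> ?H" using max \<open>z \<notin> A\<close> by blast
    then show ?thesis using z d eq pow by auto
  qed
  have "A #> d \<noteq> \<one>\<^bsub>G Mod A\<^esub>" using d eq[of d \<one>] one by simp
  moreover have "(A #> d) [^]\<^bsub>G Mod A\<^esub> p = \<one>\<^bsub>G Mod A\<^esub>"
    using pow[OF d(1), of "int p"] d(3) one by (simp add: int_pow_int)
  ultimately have "(\<exists>k::int. A #> x = (A #> y) [^]\<^bsub>G Mod A\<^esub> k) \<or> (\<exists>k::int. A #> y = (A #> x) [^]\<^bsub>G Mod A\<^esub> k)"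
    using Q.powers_comparable_if_essential[OF p car[OF d(1)] _ _ ess car[OF x] car[OF y]] by blast
  then show ?thesis using pow eq x y by simp
qed

subsection \<open>Decomposition into isotropic subsets\<close>

text \<open>\<open>P\<close> plays the role of orthogonality for an alternating form with values in
  a group of prime order. The hypothesis \<open>key\<close> says that a nonzero value generates the
  value group: any \<open>v\<close> becomes orthogonal to \<open>u\<close> after multiplication by a
  power of \<open>s\<close>.\<close>

lemma (in group) isotropic_decomposition:
  assumes cnt: "countable (carrier G)"
    and refl: "\<And>x. x \<in> carrier G \<Longrightarrow> P x x"
    and sym: "\<And>x y. x \<in> carrier G \<Longrightarrow> y \<in> carrier G \<Longrightarrow> P x y \<Longrightarrow> P y x"
    and perp: "\<And>z. z \<in> carrier G \<Longrightarrow> subgroup {x \<in> carrier G. P x z} G"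
    and key: "\<And>s u v. s \<in> carrier G \<Longrightarrow> u \<in> carrier G \<Longrightarrow> v \<in> carrier G \<Longrightarrow> \<not> P s u
      \<Longrightarrow> \<exists>k::int. P (v \<otimes> s [^] k) u"
  obtains S T where "S \<subseteq> carrier G" "T \<subseteq> carrier G" "generate G (S \<union> T) = carrier G"
    "\<forall>x\<in>S. \<forall>y\<in>S. P x y" "\<forall>x\<in>T. \<forall>y\<in>T. P x y"
proof -
  have mult: "P (x \<otimes> y) z" if "x \<in> carrier G" "y \<in> carrier G" "z \<in> carrier G" "P x z" "P y z" for x y z
    using subgroup.m_closed[OF perp[of z], of x y] that by simp
  have pow: "P (x [^] (k::int)) z" if "x \<in> carrier G" "z \<in> carrier G" "P x z" for x z k
    using subgroup_int_pow_closed[OF perp[of z], of x k] that by simp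
  have perp_sym: "P x y \<longleftrightarrow> P y x" if "x \<in> carrier G" "y \<in> carrier G" for x y
    using sym that by blast
  \<comment> \<open>The last clause is the existence of projections: each \<open>h\<close> can be
    made orthogonal to \<open>S \<union> T\<close> by a factor from the generated subgroup. Keeping
    it as an invariant lets the construction continue.\<close>
  define good where "good = (\<lambda>(S, T). S \<subseteq> carrier G \<and> T \<subseteq> carrier G
    \<and> (\<forall>x\<in>S. \<forall>y\<in>S. P x y) \<and> (\<forall>x\<in>T. \<forall>y\<in>T. P x y)
    \<and> (\<forall>h\<in>carrier G. \<exists>w\<in>generate G (S \<union> T). \<forall>z\<in>S \<union> T. P (h \<otimes> w) z))"
  have step: "\<exists>S' T'. good (S', T') \<and> S \<subseteq> S' \<and> T \<subseteq> T' \<and> t \<in> generate G (S' \<union> T')"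
    if ST: "good (S, T)" and t: "t \<in> carrier G" for S T t
  proof -
    have S: "S \<subseteq> carrier G" and T: "T \<subseteq> carrier G"
      and isoS: "\<forall>x\<in>S. \<forall>y\<in>S. P x y" and isoT: "\<forall>x\<in>T. \<forall>y\<in>T. P x y"
      and proj: "\<And>h. h \<in> carrier G \<Longrightarrow> \<exists>w\<in>generate G (S \<union> T). \<forall>z\<in>S \<union> T. P (h \<otimes> w) z"
      using ST by (auto simp: good_def)
    have gen: "generate G (S \<union> T) \<subseteq> carrier G" using S T by (intro generate_incl) auto
    obtain w where w: "w \<in> generate G (S \<union> T)" "\<forall>z\<in>S \<union> T. P (t \<otimes> w) z"
      using proj t by blast
    define s where "s = t \<otimes> w"
    have s: "s \<in> carrier G" using w gen t by (auto simp: s_def)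
    have ps: "\<forall>z\<in>S \<union> T. P s z" using w by (simp add: s_def)
    have t_eq: "t = s \<otimes> inv w" using w(1) t gen by (auto simp: s_def m_assoc)
    have t_gen: "t \<in> generate G (S' \<union> T')"
      if "insert s S \<subseteq> S'" "T \<subseteq> T'" "S' \<subseteq> carrier G" "T' \<subseteq> carrier G" for S' T'
    proof -
      have "subgroup (generate G (S' \<union> T')) G" using that by (intro generate_is_subgroup) auto
      moreover have "w \<in> generate G (S' \<union> T')"
        using w(1) mono_generate[of "S \<union> T" "S' \<union> T'"] that by blast
      moreover have "s \<in> generate G (S' \<union> T')" using that by (intro generate.incl) auto
      ultimately show ?thesis unfolding t_eq by (meson subgroup.m_closed subgroup.m_inv_closed)
    qed
    have isoS': "\<forall>x\<in>insert s S. \<forall>y\<in>insert s S. P x y"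
      using isoS ps s S refl perp_sym by blast
    show ?thesis
    proof (cases "\<forall>u\<in>carrier G. P s u")
      \<comment> \<open>Here \<open>s\<close> lies in the radical, so it joins \<open>S\<close>
        without a partner and all earlier projections remain valid.\<close>
      case True
      have "\<exists>w\<in>generate G (insert s S \<union> T). \<forall>z\<in>insert s S \<union> T. P (h \<otimes> w) z"
        if h: "h \<in> carrier G" for h
      proof -
        obtain w where w: "w \<in> generate G (S \<union> T)" "\<forall>z\<in>S \<union> T. P (h \<otimes> w) z"
          using proj h by blast
        moreover have "P (h \<otimes> w) s" using True h gen w(1) s perp_sym[of s] by blast
        ultimately show ?thesis using mono_generate[of "S \<union> T" "insert s S \<union> T"] by auto
      qed
      then have "good (insert s S, T)"
        using S T s isoS' isoT by (simp add: good_def)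
      then show ?thesis using t_gen[of "insert s S" T] S T s by blast
    next
      \<comment> \<open>Here \<open>s\<close> gets a partner \<open>r\<close>, obtained by
        projecting some \<open>u\<close> not orthogonal to \<open>s\<close>; \<open>s\<close> joins
        \<open>S\<close> and \<open>r\<close> joins \<open>T\<close>.\<close>
      case False
      then obtain u where u: "u \<in> carrier G" "\<not> P s u" by blast
      obtain v where v: "v \<in> generate G (S \<union> T)" "\<forall>z\<in>S \<union> T. P (u \<otimes> v) z"
        using proj u by blast
      have v': "v \<in> carrier G" using v gen by blast
      define r where "r = u \<otimes> v"
      have r: "r \<in> carrier G" using u v' by (simp add: r_def)
      have pr: "\<forall>z\<in>S \<union> T. P r z" using v by (simp add: r_def)
      have "S \<union> T \<subseteq> {x \<in> carrier G. P x s}" using S T s ps perp_sym by blast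
      then have "generate G (S \<union> T) \<subseteq> {x \<in> carrier G. P x s}"
        using perp[OF s] by (rule generate_subgroup_incl)
      then have "P (inv v) s"
        using v(1) subgroup.m_inv_closed[OF perp[OF s], of v] by auto
      \<comment> \<open>The correcting factor \<open>v\<close> is generated by elements orthogonal
        to \<open>s\<close>, so projecting \<open>u\<close> does not make it orthogonal to
        \<open>s\<close>.\<close>
      have nr: "\<not> P s r"
      proof
        assume "P s r"
        then have "P r s" using r s sym by simp
        then have "P (r \<otimes> inv v) s" using mult[of r "inv v" s] r s v' \<open>P (inv v) s\<close> by simp
        then show False using u v' s perp_sym[of s u] by (simp add: r_def m_assoc)
      qed
      let ?S = "insert s S" and ?T = "insert r T"
      have isoT': "\<forall>x\<in>?T. \<forall>y\<in>?T. P x y"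
      proof (intro ballI)
        fix x y assume "x \<in> ?T" "y \<in> ?T"
        then consider "x = r" "y = r" | "x = r" "y \<in> T" | "x \<in> T" "y = r" | "x \<in> T" "y \<in> T" by blast
        then show "P x y" using isoT pr r T refl perp_sym by cases blast+
      qed
      have "\<exists>w\<in>generate G (?S \<union> ?T). \<forall>z\<in>?S \<union> ?T. P (h \<otimes> w) z" if h: "h \<in> carrier G" for h
      proof -
        obtain w where w: "w \<in> generate G (S \<union> T)" "\<forall>z\<in>S \<union> T. P (h \<otimes> w) z"
          using proj h by blast
        have w': "w \<in> carrier G" using w gen by blast
        \<comment> \<open>First a power of \<open>s\<close> corrects against \<open>r\<close>, then
          a power of \<open>r\<close> corrects against \<open>s\<close>. The second keeps the first
          because \<open>P r r\<close>, and both leave orthogonality to \<open>S \<union> T\<close>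
          intact.\<close>
        obtain k :: int where k: "P (h \<otimes> w \<otimes> s [^] k) r"
          using key[OF s r _ nr, of "h \<otimes> w"] h w' by blast
        define g where "g = h \<otimes> w \<otimes> s [^] k"
        have g: "g \<in> carrier G" using h w' s by (simp add: g_def)
        have "\<not> P r s" using nr perp_sym r s by blast
        then obtain l :: int where l: "P (g \<otimes> r [^] l) s" using key[OF r s g] by blast
        have "P (g \<otimes> r [^] l) r" using k g r refl pow mult by (simp add: g_def)
        moreover have "P (g \<otimes> r [^] l) z" if z: "z \<in> S \<union> T" for z
        proof -
          have z': "z \<in> carrier G" using z S T by blast
          have "P (s [^] k) z" "P (r [^] l) z" using z z' s r ps pr by (auto intro!: pow)
          moreover have "P (h \<otimes> w) z" using w z by blast
          ultimately show ?thesis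
            using z' h w' s r mult[of "h \<otimes> w" "s [^] k" z] mult[of g "r [^] l" z] by (simp add: g_def)
        qed
        moreover have "w \<otimes> s [^] k \<otimes> r [^] l \<in> generate G (?S \<union> ?T)"
        proof -
          have sub: "subgroup (generate G (?S \<union> ?T)) G"
            using S T s r by (intro generate_is_subgroup) auto
          have "w \<in> generate G (?S \<union> ?T)"
            using w(1) mono_generate[of "S \<union> T" "?S \<union> ?T"] by blast
          moreover have "s \<in> generate G (?S \<union> ?T)" "r \<in> generate G (?S \<union> ?T)"
            by (auto intro: generate.incl)
          ultimately show ?thesis
            using sub by (intro subgroup.m_closed subgroup_int_pow_closed)
        qed
        moreover have "h \<otimes> (w \<otimes> s [^] k \<otimes> r [^] l) = g \<otimes> r [^] l"
          using h w' s r by (simp add: g_def m_assoc)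
        ultimately show ?thesis using l by (metis Un_iff insert_iff)
      qed
      then have "\<forall>h\<in>carrier G. \<exists>w\<in>generate G (?S \<union> ?T). \<forall>z\<in>?S \<union> ?T. P (h \<otimes> w) z"
        by blast
      moreover have "?S \<subseteq> carrier G" "?T \<subseteq> carrier G" using S T s r by auto
      ultimately have "good (?S, ?T)"
        unfolding good_def prod.case using isoS' isoT' by (intro conjI)
      then show ?thesis using t_gen[of ?S ?T] S T s r by blast
    qed
  qed
  define e where "e = from_nat_into (carrier G)"
  have e: "range e = carrier G" unfolding e_def using cnt by (intro range_from_nat_into) auto
  \<comment> \<open>Dependent choice builds an increasing sequence of good pairs; the
    \<open>n\<close>-th element of the enumeration is generated from stage \<open>Suc n\<close>
    on.\<close>
  have "\<exists>f. \<forall>n. good (f n) \<and> (fst (f n) \<subseteq> fst (f (Suc n)) \<and> snd (f n) \<subseteq> snd (f (Suc n))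
      \<and> e n \<in> generate G (fst (f (Suc n)) \<union> snd (f (Suc n))))"
  proof (rule dependent_nat_choice)
    have "\<one> \<in> generate G {}" by (rule generate.one)
    then have "good ({}, {})" by (auto simp: good_def)
    then show "\<exists>x. good x" by blast
  next
    fix x :: "'a set \<times> 'a set" and n :: nat
    assume "good x"
    then show "\<exists>y. good y \<and> (fst x \<subseteq> fst y \<and> snd x \<subseteq> snd y \<and> e n \<in> generate G (fst y \<union> snd y))"
      using step[of "fst x" "snd x" "e n"] e by auto
  qed
  then obtain f where good: "\<And>n. good (f n)"
    and incS: "\<And>n. fst (f n) \<subseteq> fst (f (Suc n))" and incT: "\<And>n. snd (f n) \<subseteq> snd (f (Suc n))"
    and gen: "\<And>n. e n \<in> generate G (fst (f (Suc n)) \<union> snd (f (Suc n)))"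
    by blast
  have mono: "fst (f m) \<subseteq> fst (f n)" "snd (f m) \<subseteq> snd (f n)" if "m \<le> n" for m n
    using lift_Suc_mono_le[of "\<lambda>n. fst (f n)" m n] lift_Suc_mono_le[of "\<lambda>n. snd (f n)" m n] that incS incT
    by simp_all
  let ?S = "\<Union>n. fst (f n)" and ?T = "\<Union>n. snd (f n)"
  have goodD: "fst (f n) \<subseteq> carrier G" "snd (f n) \<subseteq> carrier G"
    "\<forall>x\<in>fst (f n). \<forall>y\<in>fst (f n). P x y" "\<forall>x\<in>snd (f n). \<forall>y\<in>snd (f n). P x y" for n
    using good[of n] by (simp_all add: good_def split_beta)
  then have car: "?S \<subseteq> carrier G" "?T \<subseteq> carrier G" by blast+
  show ?thesis
  proof (rule that[OF car])
    show "generate G (?S \<union> ?T) = carrier G"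
    proof
      show "generate G (?S \<union> ?T) \<subseteq> carrier G" using car by (intro generate_incl) auto
      have "e n \<in> generate G (?S \<union> ?T)" for n
        using gen[of n] mono_generate[of "fst (f (Suc n)) \<union> snd (f (Suc n))" "?S \<union> ?T"] by blast
      then show "carrier G \<subseteq> generate G (?S \<union> ?T)" unfolding e[symmetric] by blast
    qed
    show "\<forall>x\<in>?S. \<forall>y\<in>?S. P x y"
    proof (intro ballI)
      fix x y assume "x \<in> ?S" "y \<in> ?S"
      then obtain m n where "x \<in> fst (f m)" "y \<in> fst (f n)" by blast
      then have "x \<in> fst (f (max m n))" "y \<in> fst (f (max m n))"
        using mono(1)[of m "max m n"] mono(1)[of n "max m n"] by auto
      then show "P x y" using goodD[of "max m n"] by blast
    qed
    show "\<forall>x\<in>?T. \<forall>y\<in>?T. P x y"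
    proof (intro ballI)
      fix x y assume "x \<in> ?T" "y \<in> ?T"
      then obtain m n where "x \<in> snd (f m)" "y \<in> snd (f n)" by blast
      then have "x \<in> snd (f (max m n))" "y \<in> snd (f (max m n))"
        using mono(2)[of m "max m n"] mono(2)[of n "max m n"] by auto
      then show "P x y" using goodD[of "max m n"] by blast
    qed
  qed
qed

subsection \<open>Chains of subgroups and maximality\<close>

context group
begin

text \<open>Every generated element is the value of a finite word in elements of \<open>S\<close>
  and their inverses, and there are countably many words.\<close>

lemma countable_generate:
  assumes "countable S" "S \<subseteq> carrier G"
  shows "countable (generate G S)"
proof -
  let ?W = "lists (S \<union> m_inv G ` S)"
  let ?ev = "\<lambda>l. foldr (\<otimes>) l \<one>"
  have closed: "?ev l \<in> carrier G" if "l \<in> ?W" for l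
    using that assms(2) by (induction l) auto
  have append: "?ev (l @ m) = ?ev l \<otimes> ?ev m" if "l \<in> ?W" "m \<in> ?W" for l m
    using that(1)
  proof (induction l)
    case (Cons a l)
    then have "a \<in> carrier G" "l \<in> ?W" using assms(2) by auto
    then show ?case using Cons.IH closed[of l] closed[OF that(2)] by (simp add: m_assoc)
  qed (use closed[OF that(2)] in simp)
  have "generate G S \<subseteq> ?ev ` ?W"
  proof
    fix x assume "x \<in> generate G S"
    then show "x \<in> ?ev ` ?W"
    proof induction
      case one
      show ?case by (rule image_eqI[of _ _ "[]"]) auto
    next
      case (incl h)
      then show ?case using assms(2) by (intro image_eqI[of _ _ "[h]"]) auto
    next
      case (inv h)
      then show ?case using assms(2) by (intro image_eqI[of _ _ "[inv h]"]) auto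
    next
      case (eng h1 h2)
      then obtain l m where "l \<in> ?W" "m \<in> ?W" "h1 = ?ev l" "h2 = ?ev m" by blast
      then show ?case by (intro image_eqI[of _ _ "l @ m"]) (auto simp: append simp del: foldr_append)
    qed
  qed
  moreover have "countable ?W" using assms(1) by (intro countable_lists) auto
  ultimately show ?thesis by (meson countable_image countable_subset)
qed

lemma subgroup_Union_chain:
  assumes "\<C> \<noteq> {}" "\<And>H. H \<in> \<C> \<Longrightarrow> subgroup H G"
    and "\<And>H K. H \<in> \<C> \<Longrightarrow> K \<in> \<C> \<Longrightarrow> H \<subseteq> K \<or> K \<subseteq> H"
  shows "subgroup (\<Union>\<C>) G"
proof (rule subgroupI)
  show "\<Union>\<C> \<subseteq> carrier G" using subgroup.subset[OF assms(2)] by blast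
  obtain H where H: "H \<in> \<C>" using assms(1) by blast
  then show "\<Union>\<C> \<noteq> {}" using subgroup.one_closed[OF assms(2)[OF H]] by blast
  show "inv a \<in> \<Union>\<C>" if a: "a \<in> \<Union>\<C>" for a
  proof -
    obtain K where K: "K \<in> \<C>" "a \<in> K" using a by blast
    then show ?thesis using subgroup.m_inv_closed[OF assms(2)[OF K(1)]] by blast
  qed
  show "a \<otimes> b \<in> \<Union>\<C>" if ab: "a \<in> \<Union>\<C>" "b \<in> \<Union>\<C>" for a b
  proof -
    obtain H K where "H \<in> \<C>" "a \<in> H" "K \<in> \<C>" "b \<in> K" using ab by blast
    then obtain L where L: "L \<in> \<C>" "a \<in> L" "b \<in> L" using assms(3)[of H K] by blast
    then have "a \<otimes> b \<in> L" using subgroup.m_closed[OF assms(2)[OF L(1)]] by simp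
    then show ?thesis using L(1) by (rule UnionI[rotated])
  qed
qed

text \<open>Zorn's lemma: a union of a chain of subgroups avoiding \<open>d\<close> still avoids
  \<open>d\<close>, and the trivial subgroup is a starting point because \<open>d\<close> is not the
  identity.\<close>

lemma maximal_subgroup_avoiding:
  assumes B: "subgroup B G" and d: "d \<noteq> \<one>"
  obtains A where "subgroup A G" "A \<subseteq> B" "d \<notin> A"
    "\<And>H. subgroup H G \<Longrightarrow> A \<subseteq> H \<Longrightarrow> H \<subseteq> B \<Longrightarrow> d \<notin> H \<Longrightarrow> H = A"
proof -
  let ?F = "{A. subgroup A G \<and> A \<subseteq> B \<and> d \<notin> A}"
  have "\<exists>M\<in>?F. \<forall>H\<in>?F. M \<subseteq> H \<longrightarrow> H = M"
  proof (rule subset_Zorn_nonempty)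
    have "{\<one>} \<in> ?F" using B d triv_subgroup subgroup.one_closed by auto
    then show "?F \<noteq> {}" by blast
  next
    fix \<C> assume "\<C> \<noteq> {}" "subset.chain ?F \<C>"
    then have sub: "\<C> \<subseteq> ?F" and ch: "\<forall>H\<in>\<C>. \<forall>K\<in>\<C>. H \<subseteq> K \<or> K \<subseteq> H"
      by (simp_all add: subset_chain_def)
    have "subgroup (\<Union>\<C>) G"
      using \<open>\<C> \<noteq> {}\<close>
    proof (rule subgroup_Union_chain)
      show "subgroup H G" if "H \<in> \<C>" for H using sub that by blast
      show "H \<subseteq> K \<or> K \<subseteq> H" if "H \<in> \<C>" "K \<in> \<C>" for H K using ch that by simp
    qed
    moreover have "\<forall>H\<in>\<C>. H \<subseteq> B \<and> d \<notin> H" using sub by blast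
    ultimately show "\<Union>\<C> \<in> ?F" by blast
  qed
  then obtain A where "A \<in> ?F" and max: "\<forall>H\<in>?F. A \<subseteq> H \<longrightarrow> H = A" by (elim bexE)
  then show ?thesis by (intro that[of A]) simp_all
qed

text \<open>Zorn's lemma gives a maximal commuting subset, to which any element of \<open>C\<close>
  centralizing it could be added. Working with subsets suffices: if \<open>C\<close> is a subgroup,
  the resulting equation exhibits \<open>A\<close> as an intersection of two subgroups.\<close>

lemma exists_self_centralizing_subset:
  assumes "C \<subseteq> carrier G"
  obtains A where "A \<subseteq> C" "C \<inter> centralizer G A = A"
proof -
  let ?F = "{A. A \<subseteq> C \<and> (\<forall>x\<in>A. \<forall>y\<in>A. x \<otimes> y = y \<otimes> x)}"
  have "\<exists>M\<in>?F. \<forall>H\<in>?F. M \<subseteq> H \<longrightarrow> H = M"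
  proof (rule subset_Zorn')
    fix \<C> assume "subset.chain ?F \<C>"
    then have sub: "\<And>A. A \<in> \<C> \<Longrightarrow> A \<in> ?F"
      and ch: "\<And>A B. A \<in> \<C> \<Longrightarrow> B \<in> \<C> \<Longrightarrow> A \<subseteq> B \<or> B \<subseteq> A"
      by (auto simp: subset_chain_def)
    have "x \<otimes> y = y \<otimes> x" if xy: "x \<in> \<Union>\<C>" "y \<in> \<Union>\<C>" for x y
    proof -
      obtain A B where "A \<in> \<C>" "B \<in> \<C>" "x \<in> A" "y \<in> B" using xy by blast
      then show ?thesis using sub[of A] sub[of B] ch[of A B] by blast
    qed
    then show "\<Union>\<C> \<in> ?F" using sub by blast
  qed
  then obtain M where "M \<in> ?F" and max: "\<forall>H\<in>?F. M \<subseteq> H \<longrightarrow> H = M" by (elim bexE)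
  then have M: "M \<subseteq> C" "\<forall>x\<in>M. \<forall>y\<in>M. x \<otimes> y = y \<otimes> x" by simp_all
  have "C \<inter> centralizer G M \<subseteq> M"
  proof
    fix x assume x: "x \<in> C \<inter> centralizer G M"
    then have "insert x M \<in> ?F" using M by (auto simp: centralizer_def)
    then have "insert x M = M" using max by blast
    then show "x \<in> M" by blast
  qed
  moreover have "M \<subseteq> C \<inter> centralizer G M" using M assms by (auto simp: centralizer_def)
  ultimately show ?thesis using that M(1) by blast
qed

text \<open>Each \<open>c\<close> is the product of \<open>c \<otimes> inv t\<close> in
  \<open>K\<close> and \<open>t\<close> in \<open>T\<close>. This is applied both to a finite
  transversal in the whole group and to a countable one inside the centralizer of the derived
  subgroup.\<close>

lemma centralizer_transversal_subset:
  assumes C: "subgroup C G"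
    and trans: "\<And>c. c \<in> C \<Longrightarrow> \<exists>t\<in>T. c \<otimes> inv t \<in> K" and sub: "T \<subseteq> carrier G" "K \<subseteq> carrier G"
  shows "centralizer G T \<inter> centralizer G K \<subseteq> centralizer G C"
proof
  fix g assume g: "g \<in> centralizer G T \<inter> centralizer G K"
  have gc: "g \<in> carrier G" using g by (simp add: centralizer_def)
  have "g \<otimes> c = c \<otimes> g" if c: "c \<in> C" for c
  proof -
    have c': "c \<in> carrier G" using C c subgroup.subset by blast
    obtain t where t: "t \<in> T" "c \<otimes> inv t \<in> K" using trans c by blast
    then have t': "t \<in> carrier G" using sub by blast
    have "g \<in> centralizer G {c \<otimes> inv t, t}" using g t by (auto simp: centralizer_def)
    then have "g \<in> centralizer G (generate G {c \<otimes> inv t, t})"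
      using centralizer_generate[of "{c \<otimes> inv t, t}"] c' t' by simp
    moreover have "(c \<otimes> inv t) \<otimes> t \<in> generate G {c \<otimes> inv t, t}"
      by (intro generate.eng generate.incl) auto
    moreover have "(c \<otimes> inv t) \<otimes> t = c" using c' t' by (simp add: m_assoc)
    ultimately show ?thesis by (simp add: centralizer_def)
  qed
  then show "g \<in> centralizer G C" using gc by (simp add: centralizer_def)
qed

end

subsection \<open>Groups with finite derived subgroup\<close>

locale finite_derived_group = group +
  assumes finite_derived: "finite (derived G (carrier G))"
begin

abbreviation "D \<equiv> derived G (carrier G)"
abbreviation "C \<equiv> centralizer G D"

lemma D_subset: "D \<subseteq> carrier G" and subgroup_D: "subgroup D G"
  by (simp_all add: derived_in_carrier derived_is_subgroup)

lemma subgroup_C: "subgroup C G" and C_subset: "C \<subseteq> carrier G"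
  using D_subset subgroup_centralizer subgroup.subset by blast+

lemma C_D_commute: "c \<in> C \<Longrightarrow> d \<in> D \<Longrightarrow> c \<otimes> d = d \<otimes> c"
  by (simp add: centralizer_def)

lemma commutator_in_D: "x \<in> carrier G \<Longrightarrow> y \<in> carrier G \<Longrightarrow> commutator G x y \<in> D"
  by (rule commutator_in_derived)

text \<open>\<open>C\<close> centralizes \<open>D\<close>, where all commutators lie, so the
  conjugation in the general product formula disappears.\<close>

lemma commutator_mult:
  assumes "x \<in> C" "y \<in> C" "z \<in> C"
  shows "commutator G (x \<otimes> y) z = commutator G y z \<otimes> commutator G x z"
proof -
  have car: "x \<in> carrier G" "y \<in> carrier G" "z \<in> carrier G" using assms C_subset by blast+
  then show ?thesis
    using C_D_commute[OF assms(1) commutator_in_D, of y z] by (intro commutator_mult_left) simp_all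
qed

lemma commutator_pow_right:
  assumes "x \<in> C" "y \<in> C"
  shows "commutator G x (y [^] (k::int)) = commutator G x y [^] k"
proof -
  have car: "x \<in> carrier G" "y \<in> carrier G" using assms C_subset by blast+
  then show ?thesis
    using C_D_commute[OF assms(2) commutator_in_D, of x y] by (intro commutator_int_pow_right) simp_all
qed

lemma commutator_pow_left:
  assumes "x \<in> C" "y \<in> C"
  shows "commutator G (x [^] (k::int)) y = commutator G x y [^] k"
proof -
  have car: "x \<in> carrier G" "y \<in> carrier G" using assms C_subset by auto
  have "commutator G (x [^] k) y = inv (commutator G y (x [^] k))"
    using car by (simp add: inv_commutator)
  also have "\<dots> = commutator G x y [^] k"
    using assms car by (simp add: commutator_pow_right inv_commutator flip: int_pow_inv)
  finally show ?thesis .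
qed

lemma commutator_inv:
  assumes "x \<in> C" "y \<in> C"
  shows "commutator G (inv x) y = inv (commutator G x y)"
  using commutator_pow_left[OF assms, of "- 1"] assms C_subset
  by (auto simp: int_pow_neg subset_iff)

text \<open>This is the orthogonal complement of \<open>z\<close> in \<open>H\<close> for the
  commutator form modulo \<open>E\<close>; linearity in the first argument makes it a
  subgroup.\<close>

lemma subgroup_commutator_in:
  assumes "subgroup H G" "H \<subseteq> C" "subgroup E G" "z \<in> C"
  shows "subgroup {x \<in> H. commutator G x z \<in> E} G"
proof (rule subgroupI)
  show "{x \<in> H. commutator G x z \<in> E} \<subseteq> carrier G" using assms(1) subgroup.subset by blast
  have "commutator G \<one> z = \<one>" using assms(4) C_subset by (subst commutator_eq_one_iff) auto
  then have "\<one> \<in> {x \<in> H. commutator G x z \<in> E}" using assms subgroup.one_closed by auto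
  then show "{x \<in> H. commutator G x z \<in> E} \<noteq> {}" by blast
next
  fix x assume "x \<in> {x \<in> H. commutator G x z \<in> E}"
  then show "inv x \<in> {x \<in> H. commutator G x z \<in> E}"
    using assms by (auto simp: commutator_inv subset_iff subgroup.m_inv_closed)
next
  fix x y assume "x \<in> {x \<in> H. commutator G x z \<in> E}" "y \<in> {x \<in> H. commutator G x z \<in> E}"
  then show "x \<otimes> y \<in> {x \<in> H. commutator G x z \<in> E}"
    using assms by (auto simp: commutator_mult subset_iff subgroup.m_closed)
qed

lemma countable_index_C: "countable_index G C"
  using countable_index_centralizer_finite[OF finite_derived finite_derived D_subset] .

text \<open>\<open>C\<close> and a finite set \<open>R\<close> generate the group, so the centre
  contains the intersection of their centralizers, and the finite \<open>R\<close> costs only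
  countable index.\<close>

lemma countable_index_center_if_centralizer_C:
  assumes "countable_index G (centralizer G C)"
  shows "countable_index G (group_center G)"
proof -
  obtain R where R: "finite R" "R \<subseteq> carrier G"
    "\<And>g. g \<in> carrier G \<Longrightarrow> \<exists>r\<in>R. g \<otimes> inv r \<in> C"
    using finite_transversal_centralizer_derived[OF finite_derived] by blast
  have "centralizer G R \<inter> centralizer G C \<subseteq> group_center G"
    using centralizer_transversal_subset[OF subgroup_self R(3) R(2) C_subset]
    by (simp add: centralizer_carrier)
  moreover have "countable_index G (centralizer G R \<inter> centralizer G C)"
    using assms R C_subset countable_index_centralizer_finite[OF finite_derived]
    by (intro countable_index_Int) (auto intro: subgroup_centralizer)
  ultimately show ?thesis
    using R(2) C_subset normal_imp_subgroup[OF group_center_normal]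
    by (meson countable_index_mono subgroup_centralizer subgroups_Inter_pair)
qed

text \<open>\<open>E\<close> bounds the commutators of \<open>H\<close>, and its cardinality is the
  induction measure. The inclusion \<open>E \<subseteq> C \<inter> D\<close> makes \<open>E\<close>
  finite and abelian; countability of \<open>H\<close> allows the Gram-Schmidt procedure.\<close>

lemma abelian_with_uncountable_centralizer_index_if_countable:
  assumes "subgroup H G" "H \<subseteq> C" "countable H" "\<not> countable_index G (centralizer G H)"
    and "subgroup E G" "E \<subseteq> C \<inter> D" "\<And>x y. x \<in> H \<Longrightarrow> y \<in> H \<Longrightarrow> commutator G x y \<in> E"
  shows "\<exists>B. subgroup B G \<and> B \<subseteq> C \<and> B \<subseteq> centralizer G B \<and> \<not> countable_index G (centralizer G B)"
  using assms
proof (induction "card E" arbitrary: H E rule: less_induct)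
  case less
  note H = less.prems(1) and HC = less.prems(2) and E = less.prems(5) and ED = less.prems(6)
    and comm = less.prems(7)
  have Hcar: "H \<subseteq> carrier G" using H subgroup.subset by blast
  have Ecar: "E \<subseteq> carrier G" using E subgroup.subset by blast
  have finE: "finite E" using ED finite_derived finite_subset by blast
  show ?case
  proof (cases "E = {\<one>}")
    case True
    have "x \<otimes> y = y \<otimes> x" if "x \<in> H" "y \<in> H" for x y
    proof -
      have "commutator G x y = \<one>" using comm[OF that] True by simp
      then show ?thesis using commutator_eq_one_iff that Hcar by blast
    qed
    then have "H \<subseteq> centralizer G H" using Hcar by (auto simp: centralizer_def)
    then show ?thesis using less.prems by blast
  next
    case False
    let ?F = "{F. subgroup F G \<and> F \<subset> E}"
    have "?F \<subseteq> Pow E" by blast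
    then have "finite ?F" using finE by (meson finite_Pow_iff finite_subset)
    moreover have "{\<one>} \<in> ?F" using False triv_subgroup subgroup.one_closed[OF E] by blast
    ultimately have "\<exists>m\<in>?F. \<forall>F\<in>?F. m \<subseteq> F \<longrightarrow> m = F"
      by (intro finite_has_maximal) blast+
    then obtain E0 where "E0 \<in> ?F" and max: "\<forall>F\<in>?F. E0 \<subseteq> F \<longrightarrow> E0 = F" by (elim bexE)
    then have E0: "subgroup E0 G" "E0 \<subset> E" by simp_all
    have comE: "x \<otimes> y = y \<otimes> x" if "x \<in> E" "y \<in> E" for x y
      using that ED C_D_commute by blast
    \<comment> \<open>Maximality of \<open>E0\<close> means that \<open>E0\<close> and
      \<open>d\<close> generate \<open>E\<close>, so modulo \<open>E0\<close> every element of
      \<open>E\<close> is cancelled by a power of \<open>d\<close>. The set \<open>?K\<close> below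
      is the subgroup they generate.\<close>
    have cyc: "\<exists>k::int. d [^] k \<otimes> e \<in> E0" if d: "d \<in> E" "d \<notin> E0" and e: "e \<in> E" for d e
    proof -
      have dk: "d [^] (k::int) \<in> E" for k using subgroup_int_pow_closed[OF E d(1)] .
      let ?K = "{e \<in> E. \<exists>k::int. d [^] k \<otimes> e \<in> E0}"
      have "subgroup ?K G"
      proof (rule subgroupI)
        show "?K \<subseteq> carrier G" using Ecar by blast
        have "d [^] (0::int) \<otimes> \<one> \<in> E0" using subgroup.one_closed[OF E0(1)] by simp
        then show "?K \<noteq> {}" using subgroup.one_closed[OF E] by blast
      next
        fix x assume "x \<in> ?K"
        then obtain k :: int where x: "x \<in> E" "d [^] k \<otimes> x \<in> E0" by blast
        then have ix: "inv x \<in> E" using subgroup.m_inv_closed[OF E] by blast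
        have "inv (d [^] k \<otimes> x) = inv x \<otimes> d [^] (- k)"
          using x d Ecar by (auto simp: inv_mult_group int_pow_neg subset_iff)
        also have "\<dots> = d [^] (- k) \<otimes> inv x" using comE ix dk by blast
        finally have "d [^] (- k) \<otimes> inv x \<in> E0" using subgroup.m_inv_closed[OF E0(1) x(2)] by simp
        then show "inv x \<in> ?K" using ix by blast
      next
        fix x y assume "x \<in> ?K" "y \<in> ?K"
        then obtain k l :: int where x: "x \<in> E" "d [^] k \<otimes> x \<in> E0"
          and y: "y \<in> E" "d [^] l \<otimes> y \<in> E0" by blast
        have car: "x \<in> carrier G" "y \<in> carrier G" "d \<in> carrier G" using x y d Ecar by auto
        have "d [^] (k + l) \<otimes> (x \<otimes> y) = d [^] k \<otimes> (d [^] l \<otimes> x) \<otimes> y"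
          using car by (simp add: int_pow_mult m_assoc)
        also have "d [^] l \<otimes> x = x \<otimes> d [^] l" using comE x dk by blast
        also have "d [^] k \<otimes> (x \<otimes> d [^] l) \<otimes> y = (d [^] k \<otimes> x) \<otimes> (d [^] l \<otimes> y)"
          using car by (simp add: m_assoc)
        also have "\<dots> \<in> E0" using subgroup.m_closed[OF E0(1) x(2) y(2)] .
        finally show "x \<otimes> y \<in> ?K" using subgroup.m_closed[OF E x(1) y(1)] by blast
      qed
      moreover have "E0 \<subseteq> ?K"
      proof
        fix e assume e: "e \<in> E0"
        then have "d [^] (0::int) \<otimes> e \<in> E0" using Ecar E0 by auto
        then show "e \<in> ?K" using e E0 by blast
      qed
      moreover have "d \<in> ?K"
      proof -
        have "d [^] (- 1 :: int) \<otimes> d \<in> E0"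
          using d(1) Ecar subgroup.one_closed[OF E0(1)] by (simp add: int_pow_neg subset_iff)
        then show ?thesis using d by blast
      qed
      moreover have "?K \<subseteq> E" by blast
      ultimately have "?K = E" using max[rule_format, of ?K] d by blast
      then show ?thesis using e by blast
    qed
    define P where "P x y \<longleftrightarrow> commutator G x y \<in> E0" for x y
    let ?H = "G\<lparr>carrier := H\<rparr>"
    interpret H: group ?H using H by (rule subgroup_imp_group)
    have perp: "subgroup {x \<in> H. P x z} G" if "z \<in> H" for z
      unfolding P_def using that H HC E0(1) by (intro subgroup_commutator_in) auto
    have sym: "P y x" if "x \<in> H" "y \<in> H" "P x y" for x y
    proof -
      have "inv (commutator G x y) \<in> E0" using subgroup.m_inv_closed[OF E0(1)] that(3) by (simp add: P_def)
      then show ?thesis using that Hcar by (auto simp: P_def inv_commutator subset_iff)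
    qed
    obtain S T where ST: "S \<subseteq> H" "T \<subseteq> H" "generate ?H (S \<union> T) = H"
      "\<forall>x\<in>S. \<forall>y\<in>S. P x y" "\<forall>x\<in>T. \<forall>y\<in>T. P x y"
    proof (rule H.isotropic_decomposition[of P])
      show "countable (carrier ?H)" using less.prems by simp
      show "P x x" if "x \<in> carrier ?H" for x
      proof -
        have "commutator G x x = \<one>" using that Hcar by (subst commutator_eq_one_iff) auto
        then show ?thesis using subgroup.one_closed[OF E0(1)] by (simp add: P_def)
      qed
      show "P y x" if "x \<in> carrier ?H" "y \<in> carrier ?H" "P x y" for x y
        using sym that by simp
      show "subgroup {x \<in> carrier ?H. P x z} ?H" if "z \<in> carrier ?H" for z
        using that perp[of z] H by (intro subgroup_incl) auto
      show "\<exists>k::int. P (v \<otimes>\<^bsub>?H\<^esub> s [^]\<^bsub>?H\<^esub> k) u"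
        if s: "s \<in> carrier ?H" and u: "u \<in> carrier ?H" and v: "v \<in> carrier ?H" and "\<not> P s u" for s u v
      proof -
        have suv: "s \<in> H" "u \<in> H" "v \<in> H" "s \<in> C" "u \<in> C" "v \<in> C" using s u v HC by auto
        have "\<not> commutator G s u \<in> E0" using \<open>\<not> P s u\<close> by (simp add: P_def)
        \<comment> \<open>The value of the form at \<open>s\<close> and \<open>u\<close> is nonzero
          modulo \<open>E0\<close>, so a power of it cancels the value at \<open>v\<close> and
          \<open>u\<close>; bilinearity moves the exponent onto \<open>s\<close>.\<close>
        then obtain k :: int where k: "commutator G s u [^] k \<otimes> commutator G v u \<in> E0"
          using cyc comm suv by blast
        have "s [^] k \<in> C" using subgroup_int_pow_closed[OF subgroup_C suv(4)] .
        then have "commutator G (v \<otimes> s [^] k) u = commutator G s u [^] k \<otimes> commutator G v u"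
          using suv by (simp add: commutator_mult commutator_pow_left)
        then have "P (v \<otimes> s [^] k) u" using k by (simp add: P_def)
        then show ?thesis using int_pow_consistent[OF H suv(1)] by auto
      qed
    qed auto
    have "generate G (S \<union> T) = H" using ST generate_consistent[of "S \<union> T" H] H by simp
    moreover have "S \<union> T \<subseteq> carrier G" using ST(1,2) Hcar by blast
    ultimately have "centralizer G H = centralizer G (S \<union> T)" using centralizer_generate by metis
    then have "centralizer G H = centralizer G S \<inter> centralizer G T" by (auto simp: centralizer_def)
    moreover have "subgroup (centralizer G S) G" "subgroup (centralizer G T) G"
      using ST(1,2) Hcar by (simp_all add: subgroup_centralizer)
    \<comment> \<open>If both centralizers had countable index, so would their intersection, the
      centralizer of \<open>H\<close>.\<close>
    ultimately have "\<not> countable_index G (centralizer G S) \<or> \<not> countable_index G (centralizer G T)"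
      using less.prems(4) countable_index_Int by metis
    then obtain U where U: "U \<subseteq> H" "\<forall>x\<in>U. \<forall>y\<in>U. P x y" "\<not> countable_index G (centralizer G U)"
      using ST by metis
    have genH: "generate G U \<subseteq> H" using U(1) H by (rule generate_subgroup_incl)
    \<comment> \<open>Isotropy passes from \<open>U\<close> to the generated subgroup one argument
      at a time, since orthogonal complements are subgroups.\<close>
    have P1: "P x y" if "x \<in> generate G U" "y \<in> U" for x y
    proof -
      have "generate G U \<subseteq> {x \<in> H. P x y}"
        using U that perp[of y] by (intro generate_subgroup_incl) auto
      then show ?thesis using that by blast
    qed
    have P2: "P x y" if "x \<in> generate G U" "y \<in> generate G U" for x y
    proof -
      have "U \<subseteq> {x \<in> H. P x y}" using U P1 sym that genH by blast
      then have "generate G U \<subseteq> {x \<in> H. P x y}"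
        using perp[of y] that genH by (intro generate_subgroup_incl) auto
      then show ?thesis using that by blast
    qed
    show ?thesis
    proof (rule less.hyps)
      show "card E0 < card E" using E0 finE psubset_card_mono by blast
      show "subgroup (generate G U) G" using U Hcar by (intro generate_is_subgroup) auto
      show "\<not> countable_index G (centralizer G (generate G U))"
        using U Hcar centralizer_generate[of U] by auto
      show "countable (generate G U)" using genH less.prems(3) by (rule countable_subset)
      show "commutator G x y \<in> E0" if "x \<in> generate G U" "y \<in> generate G U" for x y
        using P2 that by (simp add: P_def)
    qed (use E0 ED genH HC in auto)
  qed
qed

text \<open>If the maximal commuting \<open>A\<close> in \<open>C\<close> has a centralizer of
  countable index, then so has \<open>A\<close> itself, being
  \<open>C \<inter> centralizer G A\<close>. The obstruction must then come from a countable
  transversal of \<open>A\<close> in \<open>C\<close>.\<close>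

lemma abelian_with_uncountable_centralizer_index:
  assumes "\<not> countable_index G (group_center G)"
  shows "\<exists>B. subgroup B G \<and> B \<subseteq> C \<and> B \<subseteq> centralizer G B \<and> \<not> countable_index G (centralizer G B)"
proof -
  obtain A where A: "A \<subseteq> C" "C \<inter> centralizer G A = A"
    using exists_self_centralizing_subset[OF C_subset] by blast
  have Acar: "A \<subseteq> carrier G" using A C_subset by blast
  have cA: "subgroup (centralizer G A) G" using Acar by (rule subgroup_centralizer)
  then have subA: "subgroup A G" using A(2) subgroup_C subgroups_Inter_pair by metis
  show ?thesis
  proof (cases "countable_index G (centralizer G A)")
    case False
    then show ?thesis using A subA by blast
  next
    case True
    have ciA: "countable_index G A"
      using countable_index_Int[OF countable_index_C True subgroup_C cA] A(2) by simp
    \<comment> \<open>\<open>T\<close> contains one element of \<open>C\<close> from each coset of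
      \<open>A\<close> that meets \<open>C\<close>.\<close>
    define T where "T = inv_into C ((#>) A) ` (((#>) A) ` C)"
    have TC: "T \<subseteq> C" by (auto simp: T_def intro: inv_into_into)
    have "((#>) A) ` C \<subseteq> rcosets A" using C_subset by (auto simp: RCOSETS_def)
    then have "countable (((#>) A) ` C)" using ciA by (rule countable_subset)
    then have cntT: "countable T" unfolding T_def by (rule countable_image)
    have trans: "\<exists>t\<in>T. c \<otimes> inv t \<in> A" if c: "c \<in> C" for c
    proof
      let ?t = "inv_into C ((#>) A) (A #> c)"
      show t: "?t \<in> T" using c by (auto simp: T_def)
      have "A #> c = A #> ?t" using c by (simp add: f_inv_into_f)
      then show "c \<otimes> inv ?t \<in> A" using rcos_eq_iff[OF subA] c t TC C_subset by blast
    qed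
    have Tcar: "T \<subseteq> carrier G" using TC C_subset by blast
    \<comment> \<open>\<open>A\<close> centralizes itself, so an element of \<open>A\<close>
      commuting with \<open>T\<close> commutes with all of \<open>C\<close>.\<close>
    have "centralizer G T \<inter> A \<subseteq> centralizer G C"
      using centralizer_transversal_subset[OF subgroup_C trans Tcar Acar] A(2) by blast
    have "\<not> countable_index G (centralizer G T)"
    proof
      assume "countable_index G (centralizer G T)"
      then have "countable_index G (centralizer G T \<inter> A)"
        using ciA subA Tcar by (intro countable_index_Int) (auto intro: subgroup_centralizer)
      then have "countable_index G (centralizer G C)"
        using \<open>centralizer G T \<inter> A \<subseteq> centralizer G C\<close> subA Tcar C_subset
        by (meson countable_index_mono subgroup_centralizer subgroups_Inter_pair)
      then show False using assms countable_index_center_if_centralizer_C by blast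
    qed
    moreover have "subgroup (generate G T) G" using Tcar by (rule generate_is_subgroup)
    moreover have genC: "generate G T \<subseteq> C" using TC subgroup_C by (rule generate_subgroup_incl)
    moreover have "commutator G x y \<in> C \<inter> D" if "x \<in> generate G T" "y \<in> generate G T" for x y
    proof
      have xy: "x \<in> C" "y \<in> C" using that genC by auto
      then show "commutator G x y \<in> D" using C_subset commutator_in_D by blast
      show "commutator G x y \<in> C"
        unfolding commutator_def
        using xy subgroup.m_closed[OF subgroup_C] subgroup.m_inv_closed[OF subgroup_C] by simp
    qed
    ultimately show ?thesis
      using cntT Tcar subgroup_C subgroup_D
      by (intro abelian_with_uncountable_centralizer_index_if_countable[of "generate G T" "C \<inter> D"])
        (auto simp: centralizer_generate countable_generate intro: subgroups_Inter_pair)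
  qed
qed

text \<open>Each round excludes one element of prime order from \<open>B \<inter> D\<close>, so its
  cardinality drops. The work lies in keeping the centralizer index uncountable.\<close>

lemma abelian_avoiding_derived:
  assumes "subgroup B G" "B \<subseteq> C" "B \<subseteq> centralizer G B" "\<not> countable_index G (centralizer G B)"
  shows "\<exists>A. subgroup A G \<and> A \<subseteq> centralizer G A \<and> A \<inter> D = {\<one>} \<and> \<not> countable_index G (centralizer G A)"
  using assms
proof (induction "card (B \<inter> D)" arbitrary: B rule: less_induct)
  case less
  note B = less.prems(1) and BC = less.prems(2) and Bab = less.prems(3)
  have Bcar: "B \<subseteq> carrier G" using B subgroup.subset by blast
  show ?case
  proof (cases "B \<inter> D = {\<one>}")
    case True
    then show ?thesis using less.prems by blast
  next
    case False
    have "\<one> \<in> B \<inter> D" using subgroup.one_closed[OF B] subgroup.one_closed[OF subgroup_D] by simp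
    then obtain d0 where d0: "d0 \<in> B" "d0 \<in> D" "d0 \<noteq> \<one>" using False by blast
    have d0c: "d0 \<in> carrier G" using d0 Bcar by blast
    interpret Dg: group "G\<lparr>carrier := D\<rparr>" using subgroup_D by (rule subgroup_imp_group)
    \<comment> \<open>Lagrange's theorem in the finite group \<open>D\<close> gives
      \<open>d0\<close> finite order; a suitable power of \<open>d0\<close> then has prime order
      \<open>p\<close>.\<close>
    have "d0 [^] order (G\<lparr>carrier := D\<rparr>) = \<one>"
      using Dg.pow_order_eq_1[of d0] d0 by (simp add: nat_pow_consistent[symmetric])
    moreover have "order (G\<lparr>carrier := D\<rparr>) \<noteq> 0"
      using finite_derived d0 by (auto simp: order_def)
    ultimately have "ord d0 \<noteq> 0" using d0c ord_eq_0 by blast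
    moreover have "ord d0 \<noteq> 1" using d0 d0c ord_eq_1 by blast
    ultimately obtain p where p: "Factorial_Ring.prime p" "p dvd ord d0" using prime_factor_nat by blast
    then obtain m where m: "ord d0 = p * m" by blast
    define d where "d = d0 [^] m"
    have "\<not> ord d0 dvd m"
      using m \<open>ord d0 \<noteq> 0\<close> prime_gt_1_nat[OF p(1)] by (simp add: nat_dvd_not_less)
    then have d1: "d \<noteq> \<one>" using d0c by (simp add: d_def pow_eq_id)
    have dp: "d [^] p = \<one>"
      using m pow_ord_eq_1[OF d0c] d0c by (simp add: d_def nat_pow_pow mult.commute)
    have dBD: "d \<in> B" "d \<in> D"
      using subgroup_int_pow_closed[OF B d0(1), of "int m"]
        subgroup_int_pow_closed[OF subgroup_D d0(2), of "int m"] by (auto simp: d_def int_pow_int)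
    obtain A where A: "subgroup A G" "A \<subseteq> B" "d \<notin> A"
      and max: "\<And>H. subgroup H G \<Longrightarrow> A \<subseteq> H \<Longrightarrow> H \<subseteq> B \<Longrightarrow> d \<notin> H \<Longrightarrow> H = A"
      using maximal_subgroup_avoiding[OF B d1] by blast
    have Acar: "A \<subseteq> carrier G" using A Bcar by blast
    have AC: "A \<subseteq> C" using A BC by blast
    let ?B = "G\<lparr>carrier := B\<rparr>"
    interpret Bg: group ?B using B by (rule subgroup_imp_group)
    interpret Bg: comm_group ?B
      using Bab by (intro Bg.group_comm_groupI) (auto simp: centralizer_def)
    have comparable: "(\<exists>k::int. x \<otimes> inv (y [^] k) \<in> A) \<or> (\<exists>k::int. y \<otimes> inv (x [^] k) \<in> A)"
      if xy: "x \<in> B" "y \<in> B" for x y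
    proof -
      have "(\<exists>k::int. x \<otimes>\<^bsub>?B\<^esub> inv\<^bsub>?B\<^esub> (y [^]\<^bsub>?B\<^esub> k) \<in> A) \<or> (\<exists>k::int. y \<otimes>\<^bsub>?B\<^esub> inv\<^bsub>?B\<^esub> (x [^]\<^bsub>?B\<^esub> k) \<in> A)"
      proof (rule Bg.comparable_mod_maximal_avoiding[OF p(1)])
        show "subgroup A ?B" using A B by (intro subgroup_incl)
        show "d [^]\<^bsub>?B\<^esub> p = \<one>\<^bsub>?B\<^esub>" using dp by (simp add: nat_pow_consistent[symmetric])
        show "H = A" if "subgroup H ?B" "A \<subseteq> H" "d \<notin> H" for H
          using that max incl_subgroup[OF B that(1)] subgroup.subset[OF that(1)] by auto
      qed (use A dBD xy in auto)
      moreover have "inv\<^bsub>?B\<^esub> (z [^]\<^bsub>?B\<^esub> k) = inv (z [^] k)" if "z \<in> B" for z and k :: int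
        using that subgroup_int_pow_closed[OF B that] m_inv_consistent[OF B]
        by (simp add: int_pow_consistent[OF B that, symmetric])
      ultimately show ?thesis using xy by simp
    qed
    have "\<not> countable_index G (centralizer G A)"
    proof
      assume ciA: "countable_index G (centralizer G A)"
      \<comment> \<open>For \<open>w\<close> in \<open>W\<close>, the map sending \<open>b\<close>
        to \<open>commutator G w b\<close> is a homomorphism from \<open>B\<close> to
        \<open>D\<close> that is trivial on \<open>A\<close>. The set \<open>img b\<close> collects
        the values at \<open>b\<close> of all these maps.\<close>
      define W where "W = centralizer G A \<inter> C"
      define img where "img b = (\<lambda>w. commutator G w b) ` W" for b
      have Wcar: "W \<subseteq> carrier G" using C_subset by (auto simp: W_def)
      have imgD: "img b \<subseteq> D" if "b \<in> B" for b
        using that Wcar Bcar commutator_in_D by (auto simp: img_def)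
      have fin_img: "finite (img b)" if "b \<in> B" for b
        using imgD[OF that] finite_derived finite_subset by blast
      have "\<exists>b0. b0 \<in> B \<and> (\<forall>b. b \<in> B \<longrightarrow> card (img b) \<le> card (img b0))"
      proof (rule ex_has_greatest_nat)
        show "d0 \<in> B" by fact
        show "\<forall>b. b \<in> B \<longrightarrow> card (img b) < Suc (card D)"
          using imgD finite_derived card_mono by (metis less_Suc_eq_le)
      qed
      then obtain b0 where b0: "b0 \<in> B" and greatest: "\<And>b. b \<in> B \<Longrightarrow> card (img b) \<le> card (img b0)"
        by blast
      have b0c: "b0 \<in> carrier G" using b0 Bcar by blast
      \<comment> \<open>The element \<open>b0\<close> alone tests whether \<open>w\<close>
        centralizes \<open>B\<close>: for each \<open>y\<close> in \<open>B\<close>, one of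
        \<open>y\<close> and \<open>b0\<close> is a power of the other up to a factor in
        \<open>A\<close>.\<close>
      have "W \<inter> centralizer G {b0} \<subseteq> centralizer G B"
      proof
        fix w assume w: "w \<in> W \<inter> centralizer G {b0}"
        have wc: "w \<in> carrier G" and wA: "w \<in> centralizer G A" and wb: "w \<otimes> b0 = b0 \<otimes> w"
          using w Wcar by (auto simp: W_def centralizer_def)
        have "w \<otimes> y = y \<otimes> w" if y: "y \<in> B" for y
        proof -
          have yc: "y \<in> carrier G" and yC: "y \<in> C" using y Bcar BC by auto
          consider k :: int where "y \<otimes> inv (b0 [^] k) \<in> A" | k :: int where "b0 \<otimes> inv (y [^] k) \<in> A"
            using comparable[OF y b0] by blast
          then show ?thesis
          proof cases
            case 1
            have "subgroup (centralizer G {w}) G" using wc by (intro subgroup_centralizer) auto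
            moreover have "b0 \<in> centralizer G {w}" using wb b0c by (simp add: centralizer_def)
            moreover have "y \<otimes> inv (b0 [^] k) \<in> centralizer G {w}"
              using wA 1 Acar by (auto simp: centralizer_def)
            ultimately have "(y \<otimes> inv (b0 [^] k)) \<otimes> b0 [^] k \<in> centralizer G {w}"
              by (metis subgroup.m_closed subgroup_int_pow_closed)
            then have "y \<in> centralizer G {w}" using yc b0c by (simp add: m_assoc)
            then show ?thesis by (simp add: centralizer_def)
          next
            case 2
            define a where "a = b0 \<otimes> inv (y [^] k)"
            have a: "a \<in> A" "a \<in> carrier G" "a \<in> C" using 2 Acar AC by (auto simp: a_def)
            have b0_eq: "b0 = a \<otimes> y [^] k" using b0c yc by (simp add: a_def m_assoc)
            \<comment> \<open>The factor \<open>a\<close> drops out, because it commutes with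
              \<open>v\<close> and, lying in \<open>C\<close>, with every commutator.\<close>
            have pow: "commutator G v b0 = commutator G v y [^] k" if v: "v \<in> W" for v
            proof -
              have vc: "v \<in> carrier G" "v \<in> C" and va: "v \<otimes> a = a \<otimes> v"
                using v a by (auto simp: W_def centralizer_def)
              have "commutator G v b0 = (v \<otimes> a) \<otimes> y [^] k \<otimes> inv v \<otimes> inv (y [^] k) \<otimes> inv a"
                using vc a yc unfolding b0_eq commutator_def by (simp add: inv_mult_group m_assoc)
              also have "\<dots> = a \<otimes> commutator G v (y [^] k) \<otimes> inv a"
                using vc a yc unfolding va commutator_def by (simp add: m_assoc)
              also have "a \<otimes> commutator G v (y [^] k) = commutator G v (y [^] k) \<otimes> a"
                using C_D_commute[OF a(3) commutator_in_D] vc(1) yc by simp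
              also have "\<dots> \<otimes> inv a = commutator G v (y [^] k)"
                using vc a yc by (simp add: m_assoc)
              also have "\<dots> = commutator G v y [^] k" using vc(2) yC by (rule commutator_pow_right)
              finally show ?thesis .
            qed
            \<comment> \<open>Taking powers maps \<open>img y\<close> onto the largest image \<open>img b0\<close>, hence injectively.\<close>
            have "img b0 = (\<lambda>c. c [^] k) ` img y" using pow by (force simp: img_def)
            then have "card (img y) \<le> card ((\<lambda>c. c [^] k) ` img y)" using greatest[OF y] by simp
            then have inj: "inj_on (\<lambda>c. c [^] k) (img y)"
              using fin_img[OF y] by (metis card_image_le eq_card_imp_inj_on le_antisym)
            \<comment> \<open>Taking the identity in \<open>W\<close> shows that
              \<open>img y\<close> contains the identity, so injectivity can be applied to the
              trivial \<open>k\<close>-th power of \<open>commutator G w y\<close>.\<close>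
            have "\<one> \<in> W"
              using subgroup.one_closed[OF subgroup_C] subgroup.one_closed[OF subgroup_centralizer[OF Acar]]
              by (simp add: W_def)
            moreover have "commutator G \<one> y = \<one>" using yc by (subst commutator_eq_one_iff) auto
            ultimately have "\<one> \<in> img y" by (force simp: img_def)
            moreover have "commutator G w y \<in> img y" using w by (auto simp: img_def)
            moreover have "commutator G w y [^] k = \<one> [^] k"
              using pow[of w] w wb wc b0c commutator_eq_one_iff[of w b0] by simp
            ultimately have "commutator G w y = \<one>" using inj by (meson inj_onD)
            then show ?thesis using commutator_eq_one_iff wc yc by blast
          qed
        qed
        then show "w \<in> centralizer G B" using wc by (simp add: centralizer_def)
      qed
      moreover have cA: "subgroup (centralizer G A) G" "subgroup (centralizer G {b0}) G" "subgroup (centralizer G B) G"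
        using Acar b0c Bcar by (auto intro: subgroup_centralizer)
      moreover have W: "subgroup W G" "countable_index G W"
        unfolding W_def using cA(1) subgroup_C ciA countable_index_C
        by (auto intro: subgroups_Inter_pair countable_index_Int)
      moreover have "countable_index G (W \<inter> centralizer G {b0})"
        using W cA(2) countable_index_centralizer_singleton[OF finite_derived b0c]
        by (intro countable_index_Int)
      ultimately have "countable_index G (centralizer G B)"
        by (meson countable_index_mono subgroups_Inter_pair)
      then show False using less.prems(4) by blast
    qed
    moreover have "card (A \<inter> D) < card (B \<inter> D)"
      using A dBD finite_derived by (intro psubset_card_mono) auto
    moreover have "A \<subseteq> centralizer G A" using A(2) Bab by (auto simp: centralizer_def)
    ultimately show ?thesis using less.hyps A(1) AC by blast
  qed
qed

text \<open>For \<open>g\<close> normalizing \<open>A\<close> and \<open>a\<close> in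
  \<open>A\<close>, the commutator \<open>[g, a]\<close> is a conjugate of \<open>a\<close> times
  \<open>inv a\<close>, so it lies in \<open>A \<inter> D\<close>.\<close>

lemma normalizer_subset_centralizer:
  assumes A: "subgroup A G" and AD: "A \<inter> D = {\<one>}"
  shows "normalizer G A \<subseteq> centralizer G A"
proof
  fix g assume "g \<in> normalizer G A"
  then have g: "g \<in> carrier G" and im: "(\<lambda>u. g \<otimes> u \<otimes> inv g) ` A = A"
    using mem_normalizer_iff[OF A] by auto
  have "g \<otimes> a = a \<otimes> g" if a: "a \<in> A" for a
  proof -
    have ac: "a \<in> carrier G" using a A subgroup.subset by blast
    have "g \<otimes> a \<otimes> inv g \<in> A" using im a by blast
    then have "commutator G g a \<in> A"
      unfolding commutator_def using A a by (simp add: subgroup.m_closed subgroup.m_inv_closed)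
    then have "commutator G g a = \<one>" using AD commutator_in_D g ac by blast
    then show ?thesis using commutator_eq_one_iff g ac by blast
  qed
  then show "g \<in> centralizer G A" using g by (simp add: centralizer_def)
qed

text \<open>Otherwise the two reductions yield an abelian subgroup meeting \<open>D\<close>
  trivially with a centralizer of uncountable index. Its normalizer lies in that centralizer,
  contradicting the hypothesis.\<close>

lemma countable_index_center_if_normalizers:
  assumes "\<And>A. subgroup A G \<Longrightarrow> comm_group (G\<lparr>carrier := A\<rparr>) \<Longrightarrow> countable_index G (normalizer G A)"
  shows "countable_index G (group_center G)"
proof (rule ccontr)
  assume "\<not> countable_index G (group_center G)"
  then obtain B where "subgroup B G" "B \<subseteq> C" "B \<subseteq> centralizer G B"
    "\<not> countable_index G (centralizer G B)"
    using abelian_with_uncountable_centralizer_index by metis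
  then obtain A where A: "subgroup A G" "A \<subseteq> centralizer G A" "A \<inter> D = {\<one>}"
    "\<not> countable_index G (centralizer G A)"
    using abelian_avoiding_derived by metis
  have Acar: "A \<subseteq> carrier G" using A(1) by (rule subgroup.subset)
  interpret Ag: group "G\<lparr>carrier := A\<rparr>" using A(1) by (rule subgroup_imp_group)
  have "comm_group (G\<lparr>carrier := A\<rparr>)"
    using A(2) by (intro Ag.group_comm_groupI) (auto simp: centralizer_def)
  then have "countable_index G (normalizer G A)" using assms A by blast
  then have "countable_index G (centralizer G A)"
    using normalizer_imp_subgroup[OF Acar] subgroup_centralizer[OF Acar] normalizer_subset_centralizer[OF A(1,3)]
    by (rule countable_index_mono)
  then show False using A by blast
qed

end

section \<open>The centre inside every normalizer, and the equivalence\<close>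

lemma (in group) group_center_subset_normalizer:
  assumes U: "subgroup U G"
  shows "group_center G \<subseteq> normalizer G U"
proof
  fix z assume z: "z \<in> group_center G"
  then have zc: "z \<in> carrier G" by (simp add: group_center_def)
  have "z \<otimes> u \<otimes> inv z = u" if "u \<in> U" for u
  proof -
    have u: "u \<in> carrier G" using that U subgroup.subset by blast
    then have "z \<otimes> u = u \<otimes> z" using z by (simp add: group_center_def)
    then show ?thesis using zc u by (simp add: m_assoc)
  qed
  then show "z \<in> normalizer G U" using mem_normalizer_iff[OF U] zc by simp
qed

theorem theoremC:
  fixes G :: "('a, 'b) monoid_scheme"
  assumes "finite_by_abelian G"
  shows "(countable (carrier (G Mod group_center G)) \<longleftrightarrow>
            (\<forall>U. subgroup U G \<longrightarrow> countable (rcosets\<^bsub>G\<^esub> (normalizer G U))))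
       \<and> ((\<forall>U. subgroup U G \<longrightarrow> countable (rcosets\<^bsub>G\<^esub> (normalizer G U))) \<longleftrightarrow>
            (\<forall>A. subgroup A G \<and> comm_group (G\<lparr>carrier := A\<rparr>) \<longrightarrow>
              countable (rcosets\<^bsub>G\<^esub> (normalizer G A))))"
proof -
  interpret finite_derived_group G
    using assms by (simp add: finite_by_abelian_def finite_derived_group_def finite_derived_group_axioms_def)
  \<comment> \<open>The centre lies in every normalizer, so (i) gives (ii). Specialization gives
    (iii), and the preceding reductions lead back to (i).\<close>
  have "countable_index G (normalizer G U)"
    if "countable_index G (group_center G)" and U: "subgroup U G" for U
    using that countable_index_mono normal_imp_subgroup[OF group_center_normal]
      normalizer_imp_subgroup[OF subgroup.subset[OF U]] group_center_subset_normalizer[OF U] by blast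
  moreover have "carrier (G Mod group_center G) = rcosets\<^bsub>G\<^esub> (group_center G)"
    by (simp add: FactGroup_def)
  ultimately show ?thesis using countable_index_center_if_normalizers by metis
qed

end
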